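(* For every bistochastic matrix $T$ (of size $d\times d$), the distinguishability number satisfies $\mathcal{M}(T)\ge 2$.
   Context: Let $d$ be the dimension of the underlying finite-dimensional Hilbert space, and fix a distinguished orthonormal basis $\{|k\rangle\}_{k=1}^d$ of $\mathbb{C}^d$. A quantum channel is a completely positive trace-preserving linear map $\Phi$ on $d\times d$ complex matrices. Its classical action is the (column-)stochastic matrix $T$ with $T_{kl}=\langle k|\Phi(|l\rangle\langle l|)|k\rangle$. A set of channels $\{\Phi^{(n)}\}_{n=1}^M$ is perfectly distinguishable if there is a (possibly entangled) pure bipartite state $|\Psi\rangle\in\mathbb{C}^d\otimes\mathbb{C}^d$ such that the output states $(\Phi^{(n)}\otimes\mathcal{I})(|\Psi\rangle\langle\Psi|)$, $n=1,\dots,M$, have pairwise orthogonal supports, where $\mathcal{I}$ is the identity channel. The distinguishability number $\mathcal{M}(T)$ of a stochastic matrix $T$ is the maximal number of quantum channels that all have classical action $T$ and that can be perfectly distinguished. A matrix $T$ with nonnegative entries is bistochastic if $\sum_k T_{kl}=1$ for all $l$ and $\sum_l T_{kl}=1$ for all $k$.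
   Formalization: The dimension is assumed to satisfy d ≥ 2; for d = 1 the claim fails, since the identity is the only channel on 1×1 matrices and so M(T) = 1 for T = [1]. *)

theory Defs
  imports "HOL-Analysis.Analysis"
begin

text \<open>The Hilbert space is \<open>complex ^ 'n\<close> with \<open>d = CARD('n)\<close>; the distinguished orthonormal
  basis is the standard basis \<open>ket k\<close>, indexed by \<open>'n\<close>.\<close>

definition cdot :: "complex ^ 'n \<Rightarrow> complex ^ 'n \<Rightarrow> complex" where
  "cdot v w = (\<Sum>i\<in>UNIV. cnj (v $ i) * w $ i)"

definition ket :: "'n \<Rightarrow> complex ^ 'n" where
  "ket k = axis k 1"

definition outer :: "complex ^ 'n \<Rightarrow> complex ^ 'n \<Rightarrow> complex ^ 'n ^ 'n" where
  "outer v w = (\<chi> i j. v $ i * cnj (w $ j))"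

text \<open>The real vector space structure of the type \<open>complex ^ 'n ^ 'n\<close> only has real scalars.\<close>

definition mscale :: "complex \<Rightarrow> complex ^ 'n ^ 'n \<Rightarrow> complex ^ 'n ^ 'n" where
  "mscale c A = (\<chi> i j. c * A $ i $ j)"

text \<open>A family \<open>X a b\<close> of \<open>d \<times> d\<close> matrices, \<open>a, b < m\<close>, encodes the operator
  \<open>\<Sum>a,b. X a b \<otimes> |a\<rangle>\<langle>b|\<close> on \<open>\<complex>\<^sup>d \<otimes> \<complex>\<^sup>m\<close>, and \<open>v a\<close>, \<open>a < m\<close>, encodes the
  vector \<open>\<Sum>a. v a \<otimes> |a\<rangle>\<close>. In this encoding \<open>\<Phi> \<otimes> \<I>\<close> acts as \<open>\<Phi>\<close> on each block.
  Membership in \<open>\<real>\<^sub>\<ge>\<^sub>0\<close> says that a complex number is real and nonnegative.\<close>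

definition block_psd :: "nat \<Rightarrow> (nat \<Rightarrow> nat \<Rightarrow> complex ^ 'n ^ 'n) \<Rightarrow> bool" where
  "block_psd m X \<longleftrightarrow>
     (\<forall>v :: nat \<Rightarrow> complex ^ 'n. (\<Sum>a<m. \<Sum>b<m. cdot (v a) (X a b *v v b)) \<in> \<real>\<^sub>\<ge>\<^sub>0)"

definition completely_positive :: "(complex ^ 'n ^ 'n \<Rightarrow> complex ^ 'n ^ 'n) \<Rightarrow> bool" where
  "completely_positive \<Phi> \<longleftrightarrow>
     (\<forall>m X. block_psd m X \<longrightarrow> block_psd m (\<lambda>a b. \<Phi> (X a b)))"

definition quantum_channel :: "(complex ^ 'n ^ 'n \<Rightarrow> complex ^ 'n ^ 'n) \<Rightarrow> bool" where
  "quantum_channel \<Phi> \<longleftrightarrow>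
     Vector_Spaces.linear mscale mscale \<Phi> \<and> completely_positive \<Phi> \<and>
     (\<forall>A. trace (\<Phi> A) = trace A)"

text \<open>For a channel the diagonal matrix element below is already a nonnegative real number.\<close>

definition classical_action :: "(complex ^ 'n ^ 'n \<Rightarrow> complex ^ 'n ^ 'n) \<Rightarrow> real ^ 'n ^ 'n" where
  "classical_action \<Phi> = (\<chi> k l. Re (cdot (ket k) (\<Phi> (outer (ket l) (ket l)) *v ket k)))"

text \<open>\<open>\<Phi> \<otimes> \<I>\<close> on \<open>\<complex>\<^sup>d \<otimes> \<complex>\<^sup>d\<close>, whose coordinates are indexed by pairs
  (system, ancilla).\<close>

definition tensor_id ::
  "(complex ^ 'n ^ 'n \<Rightarrow> complex ^ 'n ^ 'n) \<Rightarrow>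
     complex ^ ('n \<times> 'n) ^ ('n \<times> 'n) \<Rightarrow> complex ^ ('n \<times> 'n) ^ ('n \<times> 'n)" where
  "tensor_id \<Phi> X =
     (\<chi> p q. \<Phi> (\<chi> i j. X $ (i, snd p) $ (j, snd q)) $ fst p $ fst q)"

text \<open>For Hermitian matrices, such as states, the range is the orthogonal complement of the
  kernel.\<close>

definition support :: "complex ^ 'n ^ 'n \<Rightarrow> (complex ^ 'n) set" where
  "support A = range (\<lambda>v. A *v v)"

definition orthogonal_supports :: "complex ^ 'n ^ 'n \<Rightarrow> complex ^ 'n ^ 'n \<Rightarrow> bool" where
  "orthogonal_supports A B \<longleftrightarrow> (\<forall>v\<in>support A. \<forall>w\<in>support B. cdot v w = 0)"

definition perfectly_distinguishable ::
  "(complex ^ 'n ^ 'n \<Rightarrow> complex ^ 'n ^ 'n) set \<Rightarrow> bool" where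
  "perfectly_distinguishable S \<longleftrightarrow>
     (\<exists>\<Psi> :: complex ^ ('n \<times> 'n). norm \<Psi> = 1 \<and>
        pairwise (\<lambda>\<Phi> \<Phi>'. orthogonal_supports (tensor_id \<Phi> (outer \<Psi> \<Psi>))
                                             (tensor_id \<Phi>' (outer \<Psi> \<Psi>))) S)"

text \<open>The maximum exists: the outputs are nonzero with pairwise orthogonal supports
  in a space of dimension \<open>d\<^sup>2\<close>, so \<open>card S \<le> d\<^sup>2\<close>, and \<open>S = {}\<close> is admissible.\<close>

definition distinguishability_number :: "real ^ 'n ^ 'n \<Rightarrow> nat" where
  "distinguishability_number T =
     Max {card S | S :: (complex ^ 'n ^ 'n \<Rightarrow> complex ^ 'n ^ 'n) set.
            finite S \<and> (\<forall>\<Phi>\<in>S. quantum_channel \<Phi> \<and> classical_action \<Phi> = T) \<and>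
            perfectly_distinguishable S}"

definition bistochastic :: "real ^ 'n ^ 'n \<Rightarrow> bool" where
  "bistochastic T \<longleftrightarrow>
     (\<forall>k l. 0 \<le> T $ k $ l) \<and>
     (\<forall>l. (\<Sum>k\<in>UNIV. T $ k $ l) = 1) \<and>
     (\<forall>k. (\<Sum>l\<in>UNIV. T $ k $ l) = 1)"

end

theory Submission
  imports Defs
begin

text \<open>Fix a permutation \<open>\<sigma> k\<close> of the columns for every row \<open>k\<close>. The Kraus operators
  \<open>A\<^sub>g = \<Sum>k. c k g |k\<rangle>\<langle>\<sigma> k g|\<close> with \<open>|c k g|\<^sup>2 = T k (\<sigma> k g)\<close> give a channel with classical action \<open>T\<close>,
  whatever the phases of the \<open>c k g\<close>. On the input \<open>\<Sum>l. sqrt (p l) |l\<rangle>|l\<rangle>\<close> the choices \<open>c = sqrt T\<close> and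
  \<open>c' = z sqrt T\<close> have orthogonal outputs iff \<open>\<Sum>k. p (\<sigma> k g) T k (\<sigma> k g) z k g = 0\<close> for all \<open>g\<close>. Unit
  numbers \<open>z\<close> with this property exist iff, for each \<open>g\<close>, no weight exceeds the sum of the others.

  If some column has no entry above \<open>1/2\<close>, let \<open>p\<close> be concentrated on it and \<open>\<sigma> = id\<close>. Otherwise the
  entries above \<open>1/2\<close> form a permutation pattern. Let \<open>y\<close>, in row \<open>\<kappa>\<close> and column \<open>i\<close>, be the largest
  of the remaining entries, and let \<open>a > 1/2\<close> be the large entry of row \<open>\<kappa>\<close>, in column \<open>j\<close>. Exchange
  \<open>y\<close> and \<open>a\<close> and let \<open>p\<close> live on \<open>{i, j}\<close> with \<open>p i (1 - y) = p j a\<close>.\<close>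

section \<open>Closing polygons with unit complex numbers\<close>

text \<open>As \<open>\<theta>\<close> runs from \<open>0\<close> to \<open>pi\<close>,
  \<open>cmod (t - w * cis \<theta>)\<close> moves continuously from
  \<open>\<bar>t - w\<bar>\<close> to \<open>t + w\<close>, so it takes the value \<open>s\<close>;
  the direction of that difference is \<open>u\<close>.\<close>

lemma unit_triangle:
  fixes s t w :: real
  assumes "0 \<le> s" "0 \<le> w" "\<bar>t - w\<bar> \<le> s" "s \<le> t + w"
  obtains u v :: complex where "cmod u = 1" "cmod v = 1"
    "complex_of_real s * u + complex_of_real w * v = complex_of_real t"
proof -
  have t: "0 \<le> t"
    using assms by linarith
  have cont: "continuous_on {0..pi} (\<lambda>\<theta>. cmod (complex_of_real t - complex_of_real w * cis \<theta>))"
    by (intro continuous_intros)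
  have 0: "cmod (complex_of_real t - complex_of_real w * cis 0) = \<bar>t - w\<bar>"
    by (simp flip: of_real_diff)
  have "cmod (complex_of_real t - complex_of_real w * cis pi) = \<bar>t + w\<bar>"
    by (simp flip: of_real_add)
  then obtain \<theta> where \<theta>: "cmod (complex_of_real t - complex_of_real w * cis \<theta>) = s"
    using IVT'[OF _ _ _ cont, of s] 0 assms t by auto
  \<comment> \<open>For \<open>s = 0\<close> the difference vanishes and has no direction; any unit
    number would do.\<close>
  define u where "u = (if s = 0 then 1 else (complex_of_real t - complex_of_real w * cis \<theta>) / s)"
  show thesis
  proof
    show "cmod u = 1"
      using \<theta> assms(1) by (auto simp: u_def norm_divide)
    show "complex_of_real s * u + complex_of_real w * cis \<theta> = complex_of_real t"
      using \<theta> by (auto simp: u_def)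
  qed simp
qed

text \<open>The real target \<open>t\<close> makes induction possible: the side \<open>w a\<close>
  closes a triangle with \<open>t\<close> and a length \<open>s\<close>, and the remaining sides
  have to reach the target \<open>s\<close>. A closed polygon is the case
  \<open>t = 0\<close>.\<close>

lemma unit_polygon_target:
  fixes w :: "'a \<Rightarrow> real"
  assumes "finite A" "\<And>k. k \<in> A \<Longrightarrow> 0 \<le> w k" "0 \<le> t" "t \<le> sum w A"
    "\<And>k. k \<in> A \<Longrightarrow> 2 * w k \<le> sum w A + t"
  shows "\<exists>z. (\<forall>k. cmod (z k) = 1) \<and> (\<Sum>k\<in>A. complex_of_real (w k) * z k) = complex_of_real t"
  using assms
proof (induction A arbitrary: t rule: finite_induct)
  case empty
  then show ?case
    by (intro exI[of _ "\<lambda>_. 1"]) auto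
next
  case (insert a A)
  \<comment> \<open>The largest length that both the triangle and the remaining sides allow; a large
    target favours the induction hypothesis \<open>2 * w k \<le> sum w A + s\<close>.\<close>
  define s where "s = min (t + w a) (sum w A)"
  have W: "0 \<le> sum w A"
    using insert.prems(1) by (simp add: sum_nonneg)
  have wa: "0 \<le> w a" "2 * w a \<le> w a + sum w A + t"
    using insert.prems(1) insert.prems(4)[of a] insert.hyps by auto
  have bounds: "\<bar>t - w a\<bar> \<le> t + w a" "\<bar>t - w a\<bar> \<le> sum w A"
    using insert.prems(2,3) insert.hyps wa by (auto simp: abs_le_iff)
  have s: "0 \<le> s" "\<bar>t - w a\<bar> \<le> s" "s \<le> t + w a" "s \<le> sum w A"
    using bounds insert.prems(2) W wa(1) by (auto simp: s_def)
  have "2 * w k \<le> sum w A + s" if "k \<in> A" for k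
  proof -
    have "w k \<le> sum w A"
      using that insert by (intro member_le_sum) auto
    moreover have "2 * w k \<le> w a + sum w A + t"
      using insert.prems(4)[of k] insert.hyps that by auto
    ultimately show ?thesis
      by (auto simp: s_def)
  qed
  then obtain z where z: "\<And>k. cmod (z k) = 1"
    "(\<Sum>k\<in>A. complex_of_real (w k) * z k) = complex_of_real s"
    using insert.IH[of s] insert.prems(1) s by auto
  obtain u v where uv: "cmod u = 1" "cmod v = 1"
    "complex_of_real s * u + complex_of_real (w a) * v = complex_of_real t"
    using unit_triangle[of s "w a" t] s wa by blast
  \<comment> \<open>Rotating all earlier phases by \<open>u\<close> turns their sum \<open>s\<close>
    into \<open>s * u\<close>.\<close>
  define z' where "z' = (\<lambda>k. if k = a then v else z k * u)"
  have "(\<Sum>k\<in>A. complex_of_real (w k) * z' k) = (\<Sum>k\<in>A. complex_of_real (w k) * z k) * u"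
    unfolding sum_distrib_right z'_def using insert.hyps by (intro sum.cong) auto
  then have "(\<Sum>k\<in>insert a A. complex_of_real (w k) * z' k) = complex_of_real t"
    using insert.hyps uv z by (simp add: z'_def add.commute)
  moreover have "cmod (z' k) = 1" for k
    using uv z by (simp add: z'_def norm_mult)
  ultimately show ?case
    by blast
qed

lemma unit_polygon:
  fixes w :: "'a :: finite \<Rightarrow> real"
  assumes "\<And>k. 0 \<le> w k" "\<And>k. 2 * w k \<le> sum w UNIV"
  shows "\<exists>z. (\<forall>k. cmod (z k) = 1) \<and> (\<Sum>k\<in>UNIV. complex_of_real (w k) * z k) = 0"
  using unit_polygon_target[of UNIV w 0] assms by (simp add: sum_nonneg)

section \<open>Output supports and the existence of the maximum\<close>

lemma Re_cdot: "Re (cdot v w) = inner v w"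
  by (simp add: cdot_def inner_vec_def inner_complex_def)

lemma cdot_self_eq_0_iff: "cdot v v = 0 \<longleftrightarrow> v = 0"
proof
  assume "cdot v v = 0"
  then have "inner v v = 0"
    by (simp flip: Re_cdot)
  then show "v = 0"
    by simp
qed (simp add: cdot_def)

lemma cdot_sum: "cdot (\<Sum>i\<in>I. f i) (\<Sum>j\<in>J. h j) = (\<Sum>i\<in>I. \<Sum>j\<in>J. cdot (f i) (h j))"
proof -
  have "cdot (\<Sum>i\<in>I. f i) (\<Sum>j\<in>J. h j) = (\<Sum>a\<in>UNIV. \<Sum>i\<in>I. \<Sum>j\<in>J. cnj (f i $ a) * h j $ a)"
    by (simp add: cdot_def sum_product)
  also have "\<dots> = (\<Sum>i\<in>I. \<Sum>a\<in>UNIV. \<Sum>j\<in>J. cnj (f i $ a) * h j $ a)"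
    by (rule sum.swap)
  also have "\<dots> = (\<Sum>i\<in>I. \<Sum>j\<in>J. cdot (f i) (h j))"
    unfolding cdot_def by (intro sum.cong refl sum.swap)
  finally show ?thesis .
qed

lemma trace_outer: "trace (outer \<Psi> \<Psi>) = complex_of_real ((norm \<Psi>)\<^sup>2)"
proof -
  have "trace (outer \<Psi> \<Psi>) = complex_of_real (\<Sum>i\<in>UNIV. (cmod (\<Psi> $ i))\<^sup>2)"
    by (simp add: trace_def outer_def complex_norm_square del: of_real_power)
  also have "(\<Sum>i\<in>UNIV. (cmod (\<Psi> $ i))\<^sup>2) = (norm \<Psi>)\<^sup>2"
    by (simp add: norm_vec_def L2_set_def sum_nonneg)
  finally show ?thesis .
qed

lemma trace_tensor_id:
  assumes "\<And>A. trace (\<Phi> A) = trace A"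
  shows "trace (tensor_id \<Phi> X) = trace X"
proof -
  have "trace (tensor_id \<Phi> X) = (\<Sum>(k, m)\<in>UNIV \<times> UNIV. \<Phi> (\<chi> i j. X $ (i, m) $ (j, m)) $ k $ k)"
    by (simp add: trace_def tensor_id_def case_prod_beta)
  also have "\<dots> = (\<Sum>k\<in>UNIV. \<Sum>m\<in>UNIV. \<Phi> (\<chi> i j. X $ (i, m) $ (j, m)) $ k $ k)"
    by (simp add: sum.cartesian_product)
  also have "\<dots> = (\<Sum>m\<in>UNIV. trace (\<Phi> (\<chi> i j. X $ (i, m) $ (j, m))))"
    unfolding trace_def by (rule sum.swap)
  also have "\<dots> = (\<Sum>m\<in>UNIV. \<Sum>k\<in>UNIV. X $ (k, m) $ (k, m))"
    unfolding assms by (simp add: trace_def)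
  also have "\<dots> = (\<Sum>k\<in>UNIV. \<Sum>m\<in>UNIV. X $ (k, m) $ (k, m))"
    by (rule sum.swap)
  also have "\<dots> = trace X"
    by (simp add: trace_def sum.cartesian_product case_prod_beta)
  finally show ?thesis .
qed

text \<open>The output has trace 1, so it is not the zero matrix. This serves the cardinality bound
  and, later, to tell the two channels apart.\<close>

lemma support_output_nonzero:
  assumes "quantum_channel \<Phi>" "norm \<Psi> = 1"
  obtains v where "v \<in> support (tensor_id \<Phi> (outer \<Psi> \<Psi>))" "v \<noteq> 0"
proof -
  have "trace (tensor_id \<Phi> (outer \<Psi> \<Psi>)) = 1"
    using assms by (simp add: trace_tensor_id quantum_channel_def trace_outer)
  then have "tensor_id \<Phi> (outer \<Psi> \<Psi>) \<noteq> 0"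
    by (auto simp: trace_def)
  then have "\<exists>v. tensor_id \<Phi> (outer \<Psi> \<Psi>) *v v \<noteq> 0"
    by (metis matrix_eq matrix_vector_mult_0)
  then show thesis
    using that by (auto simp: support_def)
qed

text \<open>One nonzero vector from each output support gives an orthogonal, hence independent
  family. The dimension is taken over the reals, so the bound is \<open>2 * d^2\<close>; it is
  wanted only for finiteness.\<close>

lemma card_perfectly_distinguishable_le:
  fixes S :: "(complex ^ 'n ^ 'n \<Rightarrow> complex ^ 'n ^ 'n) set"
  assumes "\<And>\<Phi>. \<Phi> \<in> S \<Longrightarrow> quantum_channel \<Phi>" "perfectly_distinguishable S"
  shows "card S \<le> DIM(complex ^ ('n \<times> 'n))"
proof -
  obtain \<Psi> :: "complex ^ ('n \<times> 'n)" where \<Psi>: "norm \<Psi> = 1"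
    and orth: "pairwise (\<lambda>\<Phi> \<Phi>'. orthogonal_supports (tensor_id \<Phi> (outer \<Psi> \<Psi>))
                                   (tensor_id \<Phi>' (outer \<Psi> \<Psi>))) S"
    using assms(2) by (auto simp: perfectly_distinguishable_def)
  have "\<forall>\<Phi>\<in>S. \<exists>v. v \<in> support (tensor_id \<Phi> (outer \<Psi> \<Psi>)) \<and> v \<noteq> 0"
    using support_output_nonzero[OF assms(1) \<Psi>] by metis
  then obtain f where f: "\<And>\<Phi>. \<Phi> \<in> S \<Longrightarrow> f \<Phi> \<in> support (tensor_id \<Phi> (outer \<Psi> \<Psi>)) \<and> f \<Phi> \<noteq> 0"
    by metis
  have ortho: "inner (f \<Phi>) (f \<Phi>') = 0" if "\<Phi> \<in> S" "\<Phi>' \<in> S" "\<Phi> \<noteq> \<Phi>'" for \<Phi> \<Phi>'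
  proof -
    have "cdot (f \<Phi>) (f \<Phi>') = 0"
      using orth f that by (auto simp: pairwise_def orthogonal_supports_def)
    then show ?thesis
      by (metis Re_cdot zero_complex.simps(1))
  qed
  have inj: "inj_on f S"
  proof (rule inj_onI)
    fix \<Phi> \<Phi>'
    assume "\<Phi> \<in> S" "\<Phi>' \<in> S" "f \<Phi> = f \<Phi>'"
    then show "\<Phi> = \<Phi>'"
      using ortho[of \<Phi> \<Phi>'] f[of \<Phi>'] by auto
  qed
  have "pairwise orthogonal (f ` S)"
    using ortho by (fastforce simp: pairwise_def orthogonal_def)
  moreover have "0 \<notin> f ` S"
    using f by auto
  ultimately have "independent (f ` S)"
    by (rule pairwise_orthogonal_independent)
  then have "card (f ` S) \<le> DIM(complex ^ ('n \<times> 'n))"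
    using independent_bound by blast
  then show ?thesis
    by (simp add: card_image inj)
qed

text \<open>\<open>Max\<close> is meaningful only for a finite set; the cardinality bound supplies
  the finiteness.\<close>

lemma card_le_distinguishability_number:
  assumes "finite S" "\<And>\<Phi>. \<Phi> \<in> S \<Longrightarrow> quantum_channel \<Phi> \<and> classical_action \<Phi> = T"
    "perfectly_distinguishable S"
  shows "card S \<le> distinguishability_number T"
  unfolding distinguishability_number_def
proof (rule Max_ge)
  show "finite {card S | S. finite S \<and> (\<forall>\<Phi>\<in>S. quantum_channel \<Phi> \<and> classical_action \<Phi> = T) \<and>
            perfectly_distinguishable S}"
    by (rule finite_subset[OF _ finite_atMost[of "DIM(complex ^ ('a \<times> 'a))"]])
      (use card_perfectly_distinguishable_le in blast)
qed (use assms in blast)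

section \<open>Kraus maps as quantum channels\<close>

text \<open>The operator-sum form of a channel in entries; the conjugated factor is the adjoint of
  \<open>A g\<close>.\<close>

definition kraus_map :: "('g :: finite \<Rightarrow> complex ^ 'n ^ 'n) \<Rightarrow> complex ^ 'n ^ 'n \<Rightarrow> complex ^ 'n ^ 'n" where
  "kraus_map A X =
     (\<chi> k k'. \<Sum>g\<in>UNIV. \<Sum>l\<in>UNIV. \<Sum>l'\<in>UNIV. A g $ k $ l * X $ l $ l' * cnj (A g $ k' $ l'))"

lemma linear_kraus_map: "Vector_Spaces.linear mscale mscale (kraus_map A)"
proof -
  have v: "vector_space (mscale :: complex \<Rightarrow> complex ^ 'n ^ 'n \<Rightarrow> complex ^ 'n ^ 'n)"
    by unfold_locales (simp_all add: mscale_def vec_eq_iff algebra_simps)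
  have "kraus_map A (X + Y) = kraus_map A X + kraus_map A Y" for X Y
    by (simp add: kraus_map_def vec_eq_iff distrib_left distrib_right sum.distrib)
  moreover have "kraus_map A (mscale c X) = mscale c (kraus_map A X)" for c X
    by (simp add: kraus_map_def mscale_def vec_eq_iff sum_distrib_left mult.assoc mult.left_commute[of c])
  ultimately show ?thesis
    using v by (intro Vector_Spaces.linear.intro module_hom.intro module_hom_axioms.intro)
      (simp_all add: vector_space_def module_def)
qed

definition adjoint_apply :: "complex ^ 'n ^ 'n \<Rightarrow> complex ^ 'n \<Rightarrow> complex ^ 'n" where
  "adjoint_apply A v = (\<chi> l. \<Sum>k\<in>UNIV. cnj (A $ k $ l) * v $ k)"

lemma cdot_matrix_vector: "cdot v (X *v w) = (\<Sum>k\<in>UNIV. \<Sum>k'\<in>UNIV. cnj (v $ k) * X $ k $ k' * w $ k')"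
  by (simp add: cdot_def matrix_vector_mult_def sum_distrib_left mult.assoc)

text \<open>Each Kraus operator moves across the inner product as its adjoint, which leaves forms in
  \<open>X\<close> alone; complete positivity rests on this.\<close>

lemma cdot_kraus_map:
  "cdot v (kraus_map A X *v w) = (\<Sum>g\<in>UNIV. cdot (adjoint_apply (A g) v) (X *v adjoint_apply (A g) w))"
proof -
  \<comment> \<open>With one name for the summand the reordering goes by single swaps, until the
    sums over \<open>k\<close> and \<open>k'\<close> are innermost and form the adjoint
    vectors.\<close>
  define f where "f g k k' l l' = cnj (v $ k) * A g $ k $ l * X $ l $ l' * cnj (A g $ k' $ l') * w $ k'"
    for g k k' l l'
  have "cdot v (kraus_map A X *v w) = (\<Sum>k\<in>UNIV. \<Sum>k'\<in>UNIV. \<Sum>g\<in>UNIV. \<Sum>l\<in>UNIV. \<Sum>l'\<in>UNIV. f g k k' l l')"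
    by (simp add: cdot_matrix_vector kraus_map_def sum_distrib_left sum_distrib_right f_def mult.assoc)
  also have "\<dots> = (\<Sum>k\<in>UNIV. \<Sum>g\<in>UNIV. \<Sum>k'\<in>UNIV. \<Sum>l\<in>UNIV. \<Sum>l'\<in>UNIV. f g k k' l l')"
    by (intro sum.cong refl sum.swap)
  also have "\<dots> = (\<Sum>g\<in>UNIV. \<Sum>k\<in>UNIV. \<Sum>k'\<in>UNIV. \<Sum>l\<in>UNIV. \<Sum>l'\<in>UNIV. f g k k' l l')"
    by (rule sum.swap)
  also have "\<dots> = (\<Sum>g\<in>UNIV. \<Sum>k\<in>UNIV. \<Sum>l\<in>UNIV. \<Sum>k'\<in>UNIV. \<Sum>l'\<in>UNIV. f g k k' l l')"
    by (intro sum.cong refl sum.swap)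
  also have "\<dots> = (\<Sum>g\<in>UNIV. \<Sum>l\<in>UNIV. \<Sum>k\<in>UNIV. \<Sum>k'\<in>UNIV. \<Sum>l'\<in>UNIV. f g k k' l l')"
    by (intro sum.cong refl sum.swap)
  also have "\<dots> = (\<Sum>g\<in>UNIV. \<Sum>l\<in>UNIV. \<Sum>k\<in>UNIV. \<Sum>l'\<in>UNIV. \<Sum>k'\<in>UNIV. f g k k' l l')"
    by (intro sum.cong refl sum.swap)
  also have "\<dots> = (\<Sum>g\<in>UNIV. \<Sum>l\<in>UNIV. \<Sum>l'\<in>UNIV. \<Sum>k\<in>UNIV. \<Sum>k'\<in>UNIV. f g k k' l l')"
    by (intro sum.cong refl sum.swap)
  also have "\<dots> = (\<Sum>g\<in>UNIV. cdot (adjoint_apply (A g) v) (X *v adjoint_apply (A g) w))"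
    unfolding cdot_matrix_vector
    by (intro sum.cong refl)
      (simp add: adjoint_apply_def f_def sum_distrib_left sum_distrib_right mult_ac)
  finally show ?thesis .
qed

text \<open>The block form of the output at \<open>v\<close> is a sum over \<open>g\<close> of block
  forms of the input, each at the vectors \<open>adjoint_apply (A g) (v a)\<close>.\<close>

lemma completely_positive_kraus_map:
  fixes A :: "'g :: finite \<Rightarrow> complex ^ 'n ^ 'n"
  shows "completely_positive (kraus_map A)"
  unfolding completely_positive_def block_psd_def
proof (intro allI impI)
  fix m and X :: "nat \<Rightarrow> nat \<Rightarrow> complex ^ 'n ^ 'n" and v
  assume X: "\<forall>v. (\<Sum>a<m. \<Sum>b<m. cdot (v a) (X a b *v v b)) \<in> \<real>\<^sub>\<ge>\<^sub>0"
  have "(\<Sum>a<m. \<Sum>b<m. cdot (v a) (kraus_map A (X a b) *v v b)) =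
    (\<Sum>g\<in>UNIV. \<Sum>a<m. \<Sum>b<m. cdot (adjoint_apply (A g) (v a)) (X a b *v adjoint_apply (A g) (v b)))"
    (is "?l = ?r")
  proof -
    have "?l = (\<Sum>a<m. \<Sum>g\<in>UNIV. \<Sum>b<m. cdot (adjoint_apply (A g) (v a)) (X a b *v adjoint_apply (A g) (v b)))"
      unfolding cdot_kraus_map by (intro sum.cong refl sum.swap)
    also have "\<dots> = ?r"
      by (rule sum.swap)
    finally show ?thesis .
  qed
  also have "\<dots> \<in> \<real>\<^sub>\<ge>\<^sub>0"
  proof -
    have nonneg: "sum f I \<in> \<real>\<^sub>\<ge>\<^sub>0" if "\<And>g. f g \<in> \<real>\<^sub>\<ge>\<^sub>0" for f :: "'g \<Rightarrow> complex" and I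
      by (induction I rule: infinite_finite_induct) (use that in auto)
    show ?thesis
      by (rule nonneg) (rule X[rule_format])
  qed
  finally show "(\<Sum>a<m. \<Sum>b<m. cdot (v a) (kraus_map A (X a b) *v v b)) \<in> \<real>\<^sub>\<ge>\<^sub>0" .
qed

text \<open>The hypothesis is the completeness relation: the products of the adjoint of
  \<open>A g\<close> with \<open>A g\<close> sum to the identity. It yields trace
  preservation.\<close>

lemma quantum_channel_kraus_map:
  assumes "\<And>l l'. (\<Sum>g\<in>UNIV. \<Sum>k\<in>UNIV. A g $ k $ l * cnj (A g $ k $ l')) = (if l = l' then 1 else 0)"
  shows "quantum_channel (kraus_map A)"
proof -
  have "trace (kraus_map A X) = trace X" for X
  proof -
    define f where "f g k l l' = A g $ k $ l * X $ l $ l' * cnj (A g $ k $ l')" for g k l l'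
    have "trace (kraus_map A X) = (\<Sum>k\<in>UNIV. \<Sum>g\<in>UNIV. \<Sum>l\<in>UNIV. \<Sum>l'\<in>UNIV. f g k l l')"
      by (simp add: trace_def kraus_map_def f_def)
    also have "\<dots> = (\<Sum>g\<in>UNIV. \<Sum>k\<in>UNIV. \<Sum>l\<in>UNIV. \<Sum>l'\<in>UNIV. f g k l l')"
      by (rule sum.swap)
    also have "\<dots> = (\<Sum>g\<in>UNIV. \<Sum>l\<in>UNIV. \<Sum>k\<in>UNIV. \<Sum>l'\<in>UNIV. f g k l l')"
      by (intro sum.cong refl sum.swap)
    also have "\<dots> = (\<Sum>l\<in>UNIV. \<Sum>g\<in>UNIV. \<Sum>k\<in>UNIV. \<Sum>l'\<in>UNIV. f g k l l')"
      by (rule sum.swap)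
    also have "\<dots> = (\<Sum>l\<in>UNIV. \<Sum>g\<in>UNIV. \<Sum>l'\<in>UNIV. \<Sum>k\<in>UNIV. f g k l l')"
      by (intro sum.cong refl sum.swap)
    also have "\<dots> = (\<Sum>l\<in>UNIV. \<Sum>l'\<in>UNIV. \<Sum>g\<in>UNIV. \<Sum>k\<in>UNIV. f g k l l')"
      by (intro sum.cong refl sum.swap)
    also have "\<dots> = (\<Sum>l\<in>UNIV. \<Sum>l'\<in>UNIV.
        X $ l $ l' * (\<Sum>g\<in>UNIV. \<Sum>k\<in>UNIV. A g $ k $ l * cnj (A g $ k $ l')))"
      by (simp add: f_def sum_distrib_left mult_ac)
    also have "\<dots> = trace X"
      by (simp add: assms trace_def if_distrib cong: if_cong)
    finally show ?thesis .
  qed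
  then show ?thesis
    by (simp add: quantum_channel_def linear_kraus_map completely_positive_kraus_map)
qed

lemma cdot_ket: "cdot (ket k) (A *v ket l) = A $ k $ l"
  by (simp add: cdot_matrix_vector ket_def axis_def if_distrib[of cnj] if_distribR
      if_distrib[of "\<lambda>x. x * _"] if_distrib[of "\<lambda>x. _ * x"] cong: if_cong)

lemma classical_action_kraus_map:
  "classical_action (kraus_map A) = (\<chi> k l. \<Sum>g\<in>UNIV. (cmod (A g $ k $ l))\<^sup>2)"
proof -
  have "kraus_map A (outer (ket l) (ket l)) $ k $ k = (\<Sum>g\<in>UNIV. A g $ k $ l * cnj (A g $ k $ l))" for k l
    by (simp add: kraus_map_def outer_def ket_def axis_def if_distrib[of cnj]
        if_distrib[of "\<lambda>x. x * _"] if_distrib[of "\<lambda>x. _ * x"] cong: if_cong)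
  then show ?thesis
    by (simp add: classical_action_def cdot_ket complex_mult_cnj cmod_power2 flip: complex_norm_square)
qed

section \<open>Outputs of Kraus maps on pure bipartite inputs\<close>

definition local_apply :: "complex ^ 'n ^ 'n \<Rightarrow> complex ^ ('n \<times> 'n) \<Rightarrow> complex ^ ('n \<times> 'n)" where
  "local_apply A \<Psi> = (\<chi> p. \<Sum>l\<in>UNIV. A $ fst p $ l * \<Psi> $ (l, snd p))"

text \<open>The output is the sum over \<open>g\<close> of the rank-one operators
  \<open>outer x x\<close> with \<open>x = local_apply (A g) \<Psi>\<close>, so its range lies in
  the span of these vectors.\<close>

lemma tensor_id_kraus_map:
  "tensor_id (kraus_map A) (outer \<Psi> \<Psi>) *v v =
     (\<Sum>g\<in>UNIV. \<chi> p. local_apply (A g) \<Psi> $ p * cdot (local_apply (A g) \<Psi>) v)"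
proof -
  have "tensor_id (kraus_map A) (outer \<Psi> \<Psi>) $ p $ q =
      (\<Sum>g\<in>UNIV. local_apply (A g) \<Psi> $ p * cnj (local_apply (A g) \<Psi> $ q))" for p q
    by (simp add: tensor_id_def kraus_map_def local_apply_def outer_def sum_product mult_ac)
  then show ?thesis
    by (simp add: vec_eq_iff matrix_vector_mult_def cdot_def sum_distrib_left sum_distrib_right
        sum.swap[of _ "UNIV :: ('a \<times> 'a) set"] mult.assoc)
qed

lemma orthogonal_supports_kraus_map:
  fixes \<Psi> :: "complex ^ ('n :: finite \<times> 'n)"
  assumes "\<And>g h. cdot (local_apply (A g) \<Psi>) (local_apply (B h) \<Psi>) = 0"
  shows "orthogonal_supports (tensor_id (kraus_map A) (outer \<Psi> \<Psi>)) (tensor_id (kraus_map B) (outer \<Psi> \<Psi>))"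
proof -
  have scale: "cdot (\<chi> p. u $ p * a) (\<chi> p. w $ p * b) = cnj a * b * cdot u w" for u w :: "complex ^ ('n \<times> 'n)" and a b
    by (simp add: cdot_def sum_distrib_left mult_ac)
  show ?thesis
    by (auto simp: orthogonal_supports_def support_def tensor_id_kraus_map cdot_sum scale assms)
qed

section \<open>Permuted Kraus operators and the reduction to polygons\<close>

text \<open>\<open>c\<close> is indexed by row and Kraus operator, not by row and column.\<close>

definition perm_kraus :: "('n \<Rightarrow> 'n \<Rightarrow> 'n) \<Rightarrow> ('n \<Rightarrow> 'n \<Rightarrow> complex) \<Rightarrow> 'n \<Rightarrow> complex ^ 'n ^ 'n" where
  "perm_kraus \<sigma> c g = (\<chi> k l. if l = \<sigma> k g then c k g else 0)"

text \<open>Since \<open>\<sigma> k\<close> is a bijection, exactly one \<open>g\<close> contributes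
  to position \<open>(k, l)\<close>, with weight \<open>T $ k $ l\<close>. A row of a Kraus operator
  has only one possibly nonzero entry, so the terms with \<open>l \<noteq> l'\<close>
  vanish.\<close>

lemma channel_perm_kraus:
  fixes T :: "real ^ 'n ^ 'n"
  assumes "\<And>k. bij (\<sigma> k)" "\<And>k g. (cmod (c k g))\<^sup>2 = T $ k $ \<sigma> k g" "\<And>l. (\<Sum>k\<in>UNIV. T $ k $ l) = 1"
  shows "quantum_channel (kraus_map (perm_kraus \<sigma> c))"
    and "classical_action (kraus_map (perm_kraus \<sigma> c)) = T"
proof -
  have reindex: "(\<Sum>g\<in>UNIV. if l = \<sigma> k g then T $ k $ \<sigma> k g else 0) = T $ k $ l" for k l
    using sum.reindex_bij_betw[of "\<sigma> k" UNIV UNIV "\<lambda>m. if l = m then T $ k $ m else 0"] assms(1)[of k]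
    by simp
  show "classical_action (kraus_map (perm_kraus \<sigma> c)) = T"
    by (simp add: classical_action_kraus_map perm_kraus_def vec_eq_iff assms(2) reindex
        if_distrib[of cmod] if_distrib[of "\<lambda>x. x\<^sup>2"] cong: if_cong)
  show "quantum_channel (kraus_map (perm_kraus \<sigma> c))"
  proof (rule quantum_channel_kraus_map)
    fix l l' :: 'n
    let ?A = "perm_kraus \<sigma> c"
    have "?A g $ k $ l * cnj (?A g $ k $ l') =
        complex_of_real (if l = l' then if l = \<sigma> k g then T $ k $ \<sigma> k g else 0 else 0)" for g k
      using complex_norm_square[of "c k g"] by (simp add: perm_kraus_def assms(2))
    then have "(\<Sum>g\<in>UNIV. \<Sum>k\<in>UNIV. ?A g $ k $ l * cnj (?A g $ k $ l')) = complex_of_real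
        (\<Sum>g\<in>UNIV. \<Sum>k\<in>UNIV. if l = l' then if l = \<sigma> k g then T $ k $ \<sigma> k g else 0 else 0)"
      by simp
    also have "\<dots> = complex_of_real
        (\<Sum>k\<in>UNIV. \<Sum>g\<in>UNIV. if l = l' then if l = \<sigma> k g then T $ k $ \<sigma> k g else 0 else 0)"
      by (subst sum.swap) (rule refl)
    also have "(\<Sum>k\<in>UNIV. \<Sum>g\<in>UNIV. if l = l' then if l = \<sigma> k g then T $ k $ \<sigma> k g else 0 else 0) =
        (if l = l' then 1 else 0)"
      by (simp add: reindex assms(3))
    also have "complex_of_real (if l = l' then 1 else 0) = (if l = l' then 1 else 0)"
      by simp
    finally show "(\<Sum>g\<in>UNIV. \<Sum>k\<in>UNIV. ?A g $ k $ l * cnj (?A g $ k $ l')) = (if l = l' then 1 else 0)" .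
  qed
qed

definition schmidt_state :: "('n :: finite \<Rightarrow> real) \<Rightarrow> complex ^ ('n \<times> 'n)" where
  "schmidt_state p = (\<chi> q. if fst q = snd q then complex_of_real (sqrt (p (fst q))) else 0)"

lemma norm_schmidt_state:
  assumes "\<And>l. 0 \<le> p l" "(\<Sum>l\<in>UNIV. p l) = 1"
  shows "norm (schmidt_state p) = 1"
proof -
  have "(norm (schmidt_state p))\<^sup>2 = (\<Sum>q\<in>UNIV \<times> UNIV. (cmod (schmidt_state p $ q))\<^sup>2)"
    by (simp add: norm_vec_def L2_set_def sum_nonneg)
  also have "\<dots> = (\<Sum>l\<in>UNIV. \<Sum>m\<in>UNIV. (cmod (schmidt_state p $ (l, m)))\<^sup>2)"
    by (simp add: sum.cartesian_product case_prod_beta)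
  also have "\<dots> = 1"
    using assms by (simp add: schmidt_state_def if_distrib[of cmod] if_distrib[of "\<lambda>x. x\<^sup>2"] cong: if_cong)
  finally show ?thesis
    by (simp add: power2_eq_1_iff) (metis norm_ge_zero not_one_le_zero neg_0_le_iff_le)
qed

text \<open>With the system in \<open>k\<close>, the vector of Kraus index \<open>g\<close> has only
  the ancilla coordinate \<open>\<sigma> k g\<close>. Distinct indices thus occupy disjoint
  coordinates, and only \<open>g = h\<close> leaves a condition.\<close>

lemma cdot_local_apply_perm_kraus:
  assumes "\<And>k. bij (\<sigma> k)" "\<And>l. 0 \<le> p l"
  shows "cdot (local_apply (perm_kraus \<sigma> c g) (schmidt_state p)) (local_apply (perm_kraus \<sigma> c' h) (schmidt_state p)) =
    (if g = h then \<Sum>k\<in>UNIV. complex_of_real (p (\<sigma> k g)) * cnj (c k g) * c' k g else 0)"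
proof -
  have app: "local_apply (perm_kraus \<sigma> c g) (schmidt_state p) $ (k, m) =
      (if m = \<sigma> k g then complex_of_real (sqrt (p m)) * c k g else 0)" for c g k m
    by (simp add: local_apply_def perm_kraus_def schmidt_state_def if_distrib[of "\<lambda>x. x * _"] cong: if_cong)
  have "cdot (local_apply (perm_kraus \<sigma> c g) (schmidt_state p)) (local_apply (perm_kraus \<sigma> c' h) (schmidt_state p)) =
    (\<Sum>q\<in>UNIV \<times> UNIV. cnj (local_apply (perm_kraus \<sigma> c g) (schmidt_state p) $ q) *
       local_apply (perm_kraus \<sigma> c' h) (schmidt_state p) $ q)"
    by (simp add: cdot_def)
  also have "\<dots> = (\<Sum>k\<in>UNIV. \<Sum>m\<in>UNIV. cnj (local_apply (perm_kraus \<sigma> c g) (schmidt_state p) $ (k, m)) *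
       local_apply (perm_kraus \<sigma> c' h) (schmidt_state p) $ (k, m))"
    by (simp add: sum.cartesian_product case_prod_beta)
  also have "\<dots> = (\<Sum>k\<in>UNIV. \<Sum>m\<in>UNIV. if m = \<sigma> k g then
       if g = h then complex_of_real (p (\<sigma> k g)) * cnj (c k g) * c' k g else 0 else 0)"
  proof (intro sum.cong refl)
    fix k m
    have "\<sigma> k g = \<sigma> k h \<longleftrightarrow> g = h"
      using assms(1)[of k] by (simp add: bij_def inj_eq)
    moreover have "complex_of_real (sqrt (p l)) * complex_of_real (sqrt (p l)) = complex_of_real (p l)" for l
      using assms(2)[of l] by (simp flip: of_real_mult)
    ultimately show "cnj (local_apply (perm_kraus \<sigma> c g) (schmidt_state p) $ (k, m)) *
       local_apply (perm_kraus \<sigma> c' h) (schmidt_state p) $ (k, m) = (if m = \<sigma> k g then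
       if g = h then complex_of_real (p (\<sigma> k g)) * cnj (c k g) * c' k g else 0 else 0)"
      by (auto simp: app)
  qed
  also have "\<dots> = (if g = h then \<Sum>k\<in>UNIV. complex_of_real (p (\<sigma> k g)) * cnj (c k g) * c' k g else 0)"
    by simp
  finally show ?thesis .
qed

lemma two_le_distinguishability_number:
  fixes T :: "real ^ 'n ^ 'n" and \<sigma> :: "'n \<Rightarrow> 'n \<Rightarrow> 'n"
  assumes T: "\<And>k l. 0 \<le> T $ k $ l" "\<And>l. (\<Sum>k\<in>UNIV. T $ k $ l) = 1"
    and \<sigma>: "\<And>k. bij (\<sigma> k)"
    and p: "\<And>l. 0 \<le> p l" "(\<Sum>l\<in>UNIV. p l) = 1"
    and polygon: "\<And>g k. 2 * (p (\<sigma> k g) * T $ k $ \<sigma> k g) \<le> (\<Sum>k\<in>UNIV. p (\<sigma> k g) * T $ k $ \<sigma> k g)"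
  shows "2 \<le> distinguishability_number T"
proof -
  have "\<exists>z. (\<forall>k. cmod (z k) = 1) \<and>
      (\<Sum>k\<in>UNIV. complex_of_real (p (\<sigma> k g) * T $ k $ \<sigma> k g) * z k) = 0" for g
    using p T polygon by (intro unit_polygon) auto
  then obtain z where z: "\<And>g k. cmod (z g k) = 1"
    "\<And>g. (\<Sum>k\<in>UNIV. complex_of_real (p (\<sigma> k g) * T $ k $ \<sigma> k g) * z g k) = 0"
    by metis
  define c where "c k g = complex_of_real (sqrt (T $ k $ \<sigma> k g))" for k g
  \<comment> \<open>Only phases change, so the moduli and hence the classical action stay the
    same.\<close>
  define c' where "c' k g = c k g * z g k" for k g
  define \<Phi> where "\<Phi> = kraus_map (perm_kraus \<sigma> c)"
  define \<Phi>' where "\<Phi>' = kraus_map (perm_kraus \<sigma> c')"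
  let ?\<Psi> = "schmidt_state p"
  have norm: "(cmod (c k g))\<^sup>2 = T $ k $ \<sigma> k g" "(cmod (c' k g))\<^sup>2 = T $ k $ \<sigma> k g" for k g
    using T(1) z(1) by (simp_all add: c'_def c_def norm_mult)
  have channel: "quantum_channel \<Phi>" "classical_action \<Phi> = T" "quantum_channel \<Phi>'" "classical_action \<Phi>' = T"
    unfolding \<Phi>_def \<Phi>'_def by (intro channel_perm_kraus[where T = T and \<sigma> = \<sigma>] \<sigma> norm T(2))+
  have \<Psi>: "norm ?\<Psi> = 1"
    using p by (rule norm_schmidt_state)
  have cc': "complex_of_real (p (\<sigma> k g)) * cnj (c k g) * c' k g =
      complex_of_real (p (\<sigma> k g) * T $ k $ \<sigma> k g) * z g k" for k g
    using T(1)[of k "\<sigma> k g"] by (simp add: c'_def c_def flip: of_real_mult mult.assoc) 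
  have orth: "cdot (local_apply (perm_kraus \<sigma> c g) ?\<Psi>) (local_apply (perm_kraus \<sigma> c' h) ?\<Psi>) = 0" for g h
    using z(2)[of h] by (simp add: cdot_local_apply_perm_kraus \<sigma> p(1) cc')
  \<comment> \<open>\<open>pairwise\<close> asks for both orders of the two channels; conjugate
    symmetry gives the second.\<close>
  have cdot_sym: "cdot u v = cnj (cdot v u)" for u v :: "complex ^ ('n \<times> 'n)"
    by (simp add: cdot_def mult.commute)
  have "cdot (local_apply (perm_kraus \<sigma> c' g) ?\<Psi>) (local_apply (perm_kraus \<sigma> c h) ?\<Psi>) = 0" for g h
    using orth[of h g] by (subst cdot_sym) simp
  with orth have supp:
    "orthogonal_supports (tensor_id \<Phi> (outer ?\<Psi> ?\<Psi>)) (tensor_id \<Phi>' (outer ?\<Psi> ?\<Psi>))"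
    "orthogonal_supports (tensor_id \<Phi>' (outer ?\<Psi> ?\<Psi>)) (tensor_id \<Phi> (outer ?\<Psi> ?\<Psi>))"
    unfolding \<Phi>_def \<Phi>'_def by (auto intro!: orthogonal_supports_kraus_map)
  \<comment> \<open>If the channels agreed, a nonzero vector of the common output support would be
    orthogonal to itself.\<close>
  have "\<Phi> \<noteq> \<Phi>'"
  proof
    assume "\<Phi> = \<Phi>'"
    obtain v where "v \<in> support (tensor_id \<Phi> (outer ?\<Psi> ?\<Psi>))" "v \<noteq> 0"
      using support_output_nonzero[OF channel(1) \<Psi>] .
    then have "cdot v v = 0"
      using supp(1) \<open>\<Phi> = \<Phi>'\<close> by (simp add: orthogonal_supports_def)
    then show False
      using \<open>v \<noteq> 0\<close> by (simp add: cdot_self_eq_0_iff)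
  qed
  moreover have "perfectly_distinguishable {\<Phi>, \<Phi>'}"
    unfolding perfectly_distinguishable_def using supp \<Psi> by (intro exI[of _ ?\<Psi>]) (auto simp: pairwise_def)
  then have "card {\<Phi>, \<Phi>'} \<le> distinguishability_number T"
    using channel by (intro card_le_distinguishability_number) auto
  ultimately show ?thesis
    by simp
qed

section \<open>The polygon inequalities for bistochastic matrices\<close>

text \<open>Only the Kraus indices \<open>i\<close> and \<open>j\<close> carry weight. For
  \<open>i\<close> the weights \<open>p\<close> are tuned to give a degenerate polygon; for
  \<open>j\<close> the inequalities follow from \<open>y + a \<le> 1\<close> and the maximality of
  \<open>y\<close>.\<close>

lemma two_le_distinguishability_number_large_entry:
  fixes T :: "real ^ 'n ^ 'n"
  assumes T: "bistochastic T" and ij: "i \<noteq> j"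
    and big: "1 / 2 < T $ \<kappa> $ j"
    and max: "\<And>k. k \<noteq> \<kappa> \<Longrightarrow> T $ k $ j \<le> T $ \<kappa> $ i"
  shows "2 \<le> distinguishability_number T"
proof -
  define a y where "a = T $ \<kappa> $ j" and "y = T $ \<kappa> $ i"
  have nonneg: "0 \<le> T $ k $ l" and col: "(\<Sum>k\<in>UNIV. T $ k $ l) = 1" and row: "(\<Sum>l\<in>UNIV. T $ k $ l) = 1" for k l
    using T by (auto simp: bistochastic_def)
  have "(\<Sum>l\<in>{i, j}. T $ \<kappa> $ l) \<le> (\<Sum>l\<in>UNIV. T $ \<kappa> $ l)"
    by (rule sum_mono2) (auto simp: nonneg)
  then have ay: "y + a \<le> 1" "0 \<le> y" "1 / 2 < a"
    using ij nonneg big by (auto simp: a_def y_def row)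
  \<comment> \<open>\<open>D\<close> normalizes the weights, which are in the ratio \<open>a\<close>
    to \<open>1 - y\<close>.\<close>
  define D where "D = 1 - y + a"
  have D: "0 < D"
    using ay by (simp add: D_def)
  define p where "p l = (if l = i then a / D else if l = j then (1 - y) / D else 0)" for l
  define \<sigma> where "\<sigma> k = (if k = \<kappa> then Transposition.transpose i j else id)" for k
  define w where "w g k = p (\<sigma> k g) * T $ k $ \<sigma> k g" for g k
  have split: "sum f UNIV = f \<kappa> + sum f (UNIV - {\<kappa>})" for f :: "'n \<Rightarrow> real"
    by (rule sum.remove) auto
  have rest: "(\<Sum>k\<in>UNIV - {\<kappa>}. T $ k $ l) = 1 - T $ \<kappa> $ l" for l
    using split[of "\<lambda>k. T $ k $ l"] col[of l] by simp
  have poly: "2 * w g k \<le> sum (w g) UNIV" for g k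
  proof -
    consider "g = i" | "g = j" | "g \<noteq> i" "g \<noteq> j"
      by blast
    then show ?thesis
    proof cases
      case 1
      have w\<kappa>: "w g \<kappa> = (1 - y) / D * a"
        using 1 ij by (simp add: w_def \<sigma>_def p_def a_def)
      have w: "w g k = a / D * T $ k $ i" if "k \<noteq> \<kappa>" for k
        using 1 that by (simp add: w_def \<sigma>_def p_def)
      have "sum (w g) (UNIV - {\<kappa>}) = (\<Sum>k\<in>UNIV - {\<kappa>}. a / D * T $ k $ i)"
        by (intro sum.cong) (auto simp: w)
      also have "\<dots> = a / D * (1 - y)"
        unfolding sum_distrib_left[symmetric] rest y_def ..
      \<comment> \<open>Row \<open>\<kappa>\<close> contributes exactly half of the perimeter; the
        ratio of the weights was chosen for this.\<close>
      finally have sum: "sum (w g) UNIV = 2 * (a / D * (1 - y))"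
        by (simp add: split w\<kappa>)
      show ?thesis
      proof (cases "k = \<kappa>")
        case False
        have "T $ k $ i \<le> (\<Sum>k\<in>UNIV - {\<kappa>}. T $ k $ i)"
          using False by (intro member_le_sum) (auto simp: nonneg)
        then have "a / D * T $ k $ i \<le> a / D * (1 - y)"
          using ay D by (intro mult_left_mono) (auto simp: rest y_def)
        then show ?thesis
          using False by (simp add: sum w)
      qed (simp add: w\<kappa> sum mult.commute)
    next
      case 2
      have w\<kappa>: "w g \<kappa> = a / D * y"
        using 2 ij by (simp add: w_def \<sigma>_def p_def y_def)
      have w: "w g k = (1 - y) / D * T $ k $ j" if "k \<noteq> \<kappa>" for k
        using 2 that ij by (simp add: w_def \<sigma>_def p_def)
      have "sum (w g) (UNIV - {\<kappa>}) = (\<Sum>k\<in>UNIV - {\<kappa>}. (1 - y) / D * T $ k $ j)"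
        by (intro sum.cong) (auto simp: w)
      also have "\<dots> = (1 - y) / D * (1 - a)"
        unfolding sum_distrib_left[symmetric] rest a_def ..
      finally have sum: "sum (w g) UNIV = (a * y + (1 - y) * (1 - a)) / D"
        by (simp add: split w\<kappa> add_divide_distrib)
      show ?thesis
      proof (cases "k = \<kappa>")
        case True
        \<comment> \<open>Expanding the product reduces this to
          \<open>y + a \<le> 1\<close>.\<close>
        have "2 * (a * y) \<le> a * y + (1 - y) * (1 - a)"
          using ay by (simp add: algebra_simps)
        then show ?thesis
          using True D by (simp add: sum w\<kappa> divide_right_mono)
      next
        case False
        have "T $ k $ j \<le> y"
          using max False by (simp add: y_def)
        then have "(1 - y) * T $ k $ j \<le> (1 - y) * y"
          using ay by (intro mult_left_mono) auto
        moreover \<comment> \<open>After replacing \<open>T $ k $ j\<close> by \<open>y\<close>, the polygon inequality has exactly this slack.\<close>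
        have "0 \<le> (1 - a - y) * (1 - 2 * y)"
          using ay by (intro mult_nonneg_nonneg) auto
        ultimately have "2 * ((1 - y) * T $ k $ j) \<le> a * y + (1 - y) * (1 - a)"
          by (simp add: algebra_simps)
        then show ?thesis
          using False D by (simp add: sum w divide_right_mono)
      qed
    next
      case 3
      then have "w g = (\<lambda>_. 0)"
        by (auto simp: w_def \<sigma>_def p_def)
      then show ?thesis
        by simp
    qed
  qed
  have "(\<Sum>l\<in>UNIV. p l) = (\<Sum>l\<in>{i, j}. p l)"
    by (rule sum.mono_neutral_right) (auto simp: p_def)
  also have "\<dots> = 1"
    using ij D by (simp add: p_def D_def flip: add_divide_distrib)
  finally have "(\<Sum>l\<in>UNIV. p l) = 1" .
  moreover have "0 \<le> p l" for l
    using ay D by (simp add: p_def)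
  moreover have "bij (\<sigma> k)" for k
    by (simp add: \<sigma>_def)
  ultimately show ?thesis
    using poly nonneg col by (intro two_le_distinguishability_number[of T \<sigma> p]) (auto simp: w_def)
qed

text \<open>The only nontrivial polygon has the entries of column \<open>i\<close> as sides, hence
  perimeter 1.\<close>

lemma two_le_distinguishability_number_small_column:
  fixes T :: "real ^ 'n ^ 'n"
  assumes T: "bistochastic T" and small: "\<And>k. T $ k $ i \<le> 1 / 2"
  shows "2 \<le> distinguishability_number T"
proof (rule two_le_distinguishability_number[of T "\<lambda>_. id" "\<lambda>l. if l = i then 1 else 0"])
  show "2 * ((if id g = i then 1 else 0) * T $ k $ id g)
      \<le> (\<Sum>k\<in>UNIV. (if id g = i then 1 else 0) * T $ k $ id g)" for g k
    using T small[of k] by (simp add: bistochastic_def)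
qed (use T in \<open>auto simp: bistochastic_def\<close>)

theorem proposition22:
  fixes T :: "real ^ 'n ^ 'n"
  assumes "CARD('n) \<ge> 2"
    and "bistochastic T"
  shows "distinguishability_number T \<ge> 2"
proof (cases "\<exists>i. \<forall>k. T $ k $ i \<le> 1 / 2")
  case True
  then show ?thesis
    using two_le_distinguishability_number_small_column assms(2) by blast
next
  case False
  then have "\<exists>k. 1 / 2 < T $ k $ i" for i
    by (meson not_le)
  then obtain \<pi> where \<pi>: "\<And>i. 1 / 2 < T $ \<pi> i $ i"
    by metis
  have nonneg: "0 \<le> T $ k $ l" and row: "(\<Sum>l\<in>UNIV. T $ k $ l) = 1" for k l
    using assms(2) by (auto simp: bistochastic_def)
  \<comment> \<open>Two entries above \<open>1 / 2\<close> in one row would exceed the row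
    sum.\<close>
  have "inj \<pi>"
  proof (rule injI, rule ccontr)
    fix i j
    assume *: "\<pi> i = \<pi> j" "i \<noteq> j"
    have "(\<Sum>l\<in>{i, j}. T $ \<pi> i $ l) \<le> (\<Sum>l\<in>UNIV. T $ \<pi> i $ l)"
      by (rule sum_mono2) (auto simp: nonneg)
    then show False
      using * \<pi>[of i] \<pi>[of j] by (simp add: row)
  qed
  then have "surj \<pi>"
    by (simp add: finite_UNIV_inj_surj)
  define E where "E = {(k, i). k \<noteq> \<pi> i}"
  \<comment> \<open>Dimension at least two provides a position outside the pattern, so a largest
    remaining entry exists; for \<open>d = 1\<close> the set \<open>E\<close> would be
    empty.\<close>
  obtain u v :: 'n where "u \<noteq> v"
    using assms(1) by (metis card_2_iff' ex_card iso_tuple_UNIV_I finite)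
  then have "(\<pi> u, v) \<in> E"
    using \<open>inj \<pi>\<close> by (simp add: E_def inj_eq)
  moreover have "finite E"
    by (rule finite)
  ultimately obtain e where e: "e \<in> E" "\<And>e'. e' \<in> E \<Longrightarrow> T $ fst e' $ snd e' \<le> T $ fst e $ snd e"
    using finite_has_maximal[of "(\<lambda>e. T $ fst e $ snd e) ` E"] by (auto, force)
  obtain \<kappa> i where \<kappa>i: "e = (\<kappa>, i)"
    by fastforce
  obtain j where j: "\<pi> j = \<kappa>"
    using \<open>surj \<pi>\<close> by (metis surjD)
  show ?thesis
  proof (rule two_le_distinguishability_number_large_entry[of T i j \<kappa>])
    show "i \<noteq> j"
      using e(1) j by (auto simp: \<kappa>i E_def)
    show "1 / 2 < T $ \<kappa> $ j"
      using \<pi>[of j] j by simp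
    \<comment> \<open>As \<open>\<kappa> = \<pi> j\<close>, every other position of column
      \<open>j\<close> lies in \<open>E\<close>.\<close>
    show "T $ k $ j \<le> T $ \<kappa> $ i" if "k \<noteq> \<kappa>" for k
      using e(2)[of "(k, j)"] that j by (simp add: E_def \<kappa>i)
  qed (rule assms(2))
qed

end
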